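(* Let $f: X \to \mathbb{R}$, $f(u) = \tfrac12 \|\tilde F(u) - \tilde y\|^2$, be a nonlinear least-squares objective. Assume that $\mathrm{LMA}: u_k \mapsto s_k$ computes the Levenberg–Marquardt trust region update steps (as described in the context) for minimizing $f$, with Levenberg–Marquardt parameter $\beta_k \ge 0$, trust region radius $\Delta_k$ and acceptance parameter $\eta \in (0,\tfrac14)$, where the following assumptions hold: (i) the level set $\mathcal{L} = \{u \in X : f(u) \le f(u_0)\}$ is bounded, and the residual functions $r_j(\cdot)$, $j=1,\dots,m$ (the components of $u \mapsto \tilde F(u) - \tilde y$) are Lipschitz continuously differentiable in a neighborhood of $\mathcal{L}$; (ii) there are constants $c_1 > 0$ and $\gamma \ge 1$ such that for each $k$ the (approximate) Levenberg–Marquardt step $s_k$ satisfies $\|s_k\| \le \gamma \Delta_k$ and $$m_k(0) - m_k(s_k) \ \ge\ c_1 \big\| \tilde F_k'^{*}[r_k] \big\| \min\left\{ \Delta_k,\ \frac{\|\tilde F_k'^{*}[r_k]\|}{\|\tilde F_k'^{*}\tilde F_k'\|} \right\}.$$ Let $G: X \times X \to X$ be an operator of the form $G(u,s) = u + L(s) \odot g(u,s)$, where $L: X \to X$ is bounded and linear, $g: X \times X \to X$ is bounded, and $\odot$ is the elementwise product. Let $$s_k = \mathrm{LMA}(u_k), \qquad \tilde u_k = G(u_k, s_k), \qquad \tilde s_k = G(u_k,s_k) - u_k, \qquad \rho_k(s) = \frac{f(u_k) - f(u_k+s)}{m_k(0) - m_k(s)}.$$ Then, for fixed $\kappa > 0$,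 the iterates $$u_{k+1} = \begin{cases} \tilde u_k, & \text{if } m_k(\tilde s_k) \le m_k(s_k) \text{ and } \rho_k(\tilde s_k) > \kappa, \\ u_k + s_k, & \text{otherwise,} \end{cases}$$ converge to a critical point of $f$.
   Context: Setting. $X=\mathbb{R}^n$ with the Euclidean norm, $\tilde F: X \to \mathbb{R}^m$ is differentiable, and $\tilde y \in \mathbb{R}^m$ is fixed data. (In the application, $u = (\lambda,\mu)$ stacks discretized emission and attenuation images, $\tilde F(u) = (F(\lambda,\mu), \alpha_1 P_1\lambda, \alpha_2 P_2\mu)$ stacks the forward operator $F$ (a discretized attenuated Radon transform) and linear regularization operators $P_1,P_2$ with fixed weights $\alpha_1,\alpha_2>0$, and $\tilde y = (y^\delta,0,0)$ with noisy data $y^\delta$.) A point $u^*$ is a critical point of $f$ if $\nabla f(u^* ) = 0$. Notation at the $k$-th iterate $u_k$: $r_k = \tilde F(u_k) - \tilde y$ is the residual, $\tilde F_k' = D\tilde F(u_k)$ is the derivative and $\tilde F_k'^{*}$ its adjoint, so $\nabla f(u_k) = \tilde F_k'^{*}[r_k]$. The model function is $$m_k(s) = \tfrac12 \|r_k\|^2 + \langle \tilde F_k' s, r_k\rangle + \tfrac12 \|\tilde F_k' s\|^2 .$$ Levenberg–Marquardt step: for a parameter $\beta_k \ge 0$, $s_k$ is an (approximate) solution of $$\min_{s \in \tilde{\mathcal C}} \ \|\tilde F_k'[s] + r_k\|_2^2 + \beta_k \|s\|_2^2, \qquad \tilde{\mathcal C} = \{ s : u_k + s \in \mathcal C\},$$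 where $\mathcal C \subset X$ is a given constraint set defined by linear and box bounds. The parameter $\beta_k$ is tied to a trust region $\|s\| \le \Delta_k$ in which $m_k$ is regarded as a good approximation of $f(u_k+\cdot)$. Trust region update scheme (in the style of Algorithm 4.1 of Nocedal and Wright, Numerical Optimization): given a maximal radius $\hat\Delta>0$, $\Delta_0 \in (0,\hat\Delta)$ and $\eta \in (0,\tfrac14)$, a trial step $s$ is computed and the agreement ratio $\rho_k(s) = \frac{f(u_k)-f(u_k+s)}{m_k(0)-m_k(s)}$ is evaluated. If $\rho_k(s) < \tfrac14$, the radius is multiplied by $\tfrac14$; if $\rho_k(s) > \tfrac34$ and $\|s\| = \Delta_k$, the radius is replaced by $\min\{2\Delta_k, \hat\Delta\}$; otherwise it is kept. A trial step is accepted only if $\rho_k(s) > \eta$; otherwise it is rejected and a new trial step is computed from the same $u_k$ with the updated radius (and correspondingly updated $\beta_k$). $\mathrm{LMA}(u_k)$ denotes the accepted step $s_k$, so $\rho_k(s_k) > \eta$. "Bounded" for $g$ means that its range is norm-bounded.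
   Formalization: Since the iterates themselves need not converge, the conclusion is read as: the gradients of f at the iterates tend to 0 and every subsequence has a further subsequence converging to a critical point; assumption (ii) is required of all trial steps, rejected ones included. *)

theory Defs
  imports "HOL-Analysis.Analysis"
begin

definition gradient :: "('a::real_inner \<Rightarrow> real) \<Rightarrow> 'a \<Rightarrow> 'a" where
  "gradient f u = (THE g. GDERIV f u :> g)"

definition critical_point :: "('a::real_inner \<Rightarrow> real) \<Rightarrow> 'a \<Rightarrow> bool" where
  "critical_point f u \<longleftrightarrow> GDERIV f u :> 0"

text \<open>Throughout, \<open>F\<close> is the forward operator and \<open>y\<close> the data.\<close>

definition residual :: "('a \<Rightarrow> 'b::ab_group_add) \<Rightarrow> 'b \<Rightarrow> 'a \<Rightarrow> 'b" where
  "residual F y u = F u - y"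

definition lsq :: "('a \<Rightarrow> 'b::real_normed_vector) \<Rightarrow> 'b \<Rightarrow> 'a \<Rightarrow> real" where
  "lsq F y u = 1/2 * (norm (residual F y u))\<^sup>2"

abbreviation dF :: "('a::real_normed_vector \<Rightarrow> 'b::real_normed_vector) \<Rightarrow> 'a \<Rightarrow> 'a \<Rightarrow> 'b" where
  "dF F u \<equiv> frechet_derivative F (at u)"

definition model ::
  "('a::real_normed_vector \<Rightarrow> 'b::real_inner) \<Rightarrow> 'b \<Rightarrow> 'a \<Rightarrow> 'a \<Rightarrow> real" where
  "model F y u s = 1/2 * (norm (residual F y u))\<^sup>2
     + dF F u s \<bullet> residual F y u + 1/2 * (norm (dF F u s))\<^sup>2"

definition agreement_ratio ::
  "('a::real_normed_vector \<Rightarrow> 'b::real_inner) \<Rightarrow> 'b \<Rightarrow> 'a \<Rightarrow> 'a \<Rightarrow> real" where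
  "agreement_ratio F y u s =
     (lsq F y u - lsq F y (u + s)) / (model F y u 0 - model F y u s)"

definition lm_objective ::
  "('a::real_normed_vector \<Rightarrow> 'b::real_normed_vector) \<Rightarrow> 'b \<Rightarrow> real \<Rightarrow> 'a \<Rightarrow> 'a \<Rightarrow> real" where
  "lm_objective F y \<beta> u s = (norm (dF F u s + residual F y u))\<^sup>2 + \<beta> * (norm s)\<^sup>2"

text \<open>
  An approximate solution of the constrained Levenberg--Marquardt subproblem is a feasible
  step that is optimal up to a tolerance \<open>\<epsilon>\<close>; an exact solution is the case \<open>\<epsilon> = 0\<close>.
  The size of \<open>\<epsilon>\<close> is not restricted: the required quality of the steps is expressed by
  the sufficient-decrease condition \<open>sufficient_step\<close> below.
\<close>

definition lm_solution ::
  "('a::real_normed_vector \<Rightarrow> 'b::real_normed_vector) \<Rightarrow> 'b \<Rightarrow> 'a set \<Rightarrow> real \<Rightarrow> real \<Rightarrow> 'a \<Rightarrow> 'a \<Rightarrow> bool"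
  where
  "lm_solution F y C \<beta> \<epsilon> u s \<longleftrightarrow> u + s \<in> C \<and>
     (\<forall>t. u + t \<in> C \<longrightarrow> lm_objective F y \<beta> u s \<le> lm_objective F y \<beta> u t + \<epsilon>)"

definition radius_update ::
  "('a::real_normed_vector \<Rightarrow> 'b::real_inner) \<Rightarrow> 'b \<Rightarrow> real \<Rightarrow> 'a \<Rightarrow> 'a \<Rightarrow> real \<Rightarrow> real" where
  "radius_update F y \<Delta>max u s \<Delta> =
     (if agreement_ratio F y u s < 1/4 then \<Delta> / 4
      else if agreement_ratio F y u s > 3/4 \<and> norm s = \<Delta> then min (2 * \<Delta>) \<Delta>max
      else \<Delta>)"

text \<open>
  The trial loop at a fixed iterate \<open>u\<close>: \<open>t j\<close>, \<open>\<Delta> j\<close>, \<open>\<beta> j\<close>, \<open>\<epsilon> j\<close> are the trial step,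
  radius, parameter and tolerance of the \<open>j\<close>-th trial; trials \<open>0, ..., n - 1\<close> are rejected
  and trial \<open>n\<close> is accepted.
\<close>

definition lma_trials ::
  "('a::real_normed_vector \<Rightarrow> 'b::real_inner) \<Rightarrow> 'b \<Rightarrow> 'a set \<Rightarrow> real \<Rightarrow> real \<Rightarrow> 'a \<Rightarrow>
   nat \<Rightarrow> (nat \<Rightarrow> 'a) \<Rightarrow> (nat \<Rightarrow> real) \<Rightarrow> (nat \<Rightarrow> real) \<Rightarrow> (nat \<Rightarrow> real) \<Rightarrow> bool" where
  "lma_trials F y C \<Delta>max \<eta> u n t \<Delta> \<beta> \<epsilon> \<longleftrightarrow>
     (\<forall>j\<le>n. \<beta> j \<ge> 0 \<and> \<epsilon> j \<ge> 0 \<and> lm_solution F y C (\<beta> j) (\<epsilon> j) u (t j)) \<and>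
     (\<forall>j<n. agreement_ratio F y u (t j) \<le> \<eta> \<and>
            \<Delta> (Suc j) = radius_update F y \<Delta>max u (t j) (\<Delta> j)) \<and>
     agreement_ratio F y u (t n) > \<eta>"

text \<open>
  The accepted steps \<open>s k\<close> along the iterates \<open>u k\<close>. The radius obtained from the accepted
  trial is the initial radius at the next iterate, even if the next iterate is not \<open>u k + s k\<close>.
  At a critical point the method has terminated; this is encoded by \<open>s k = 0\<close>, since
  acceptance is impossible there (the predicted decrease cannot be positive).
\<close>

definition lma_steps ::
  "('a::real_inner \<Rightarrow> 'b::real_inner) \<Rightarrow> 'b \<Rightarrow> 'a set \<Rightarrow> real \<Rightarrow> real \<Rightarrow> (nat \<Rightarrow> 'a) \<Rightarrow>
   (nat \<Rightarrow> nat) \<Rightarrow> (nat \<Rightarrow> nat \<Rightarrow> 'a) \<Rightarrow> (nat \<Rightarrow> nat \<Rightarrow> real) \<Rightarrow> (nat \<Rightarrow> nat \<Rightarrow> real) \<Rightarrow>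
   (nat \<Rightarrow> nat \<Rightarrow> real) \<Rightarrow> (nat \<Rightarrow> 'a) \<Rightarrow> bool" where
  "lma_steps F y C \<Delta>max \<eta> u n t \<Delta> \<beta> \<epsilon> s \<longleftrightarrow>
     (\<forall>k. if critical_point (lsq F y) (u k) then s k = 0
          else lma_trials F y C \<Delta>max \<eta> (u k) (n k) (t k) (\<Delta> k) (\<beta> k) (\<epsilon> k) \<and>
               s k = t k (n k) \<and>
               \<Delta> (Suc k) 0 = radius_update F y \<Delta>max (u k) (s k) (\<Delta> k (n k)))"

text \<open>The step bound and the Cauchy-type decrease of the model, for a step \<open>s\<close> computed with
  radius \<open>\<Delta>\<close>.\<close>

definition sufficient_step ::
  "('a::euclidean_space \<Rightarrow> 'b::euclidean_space) \<Rightarrow> 'b \<Rightarrow> real \<Rightarrow> real \<Rightarrow> 'a \<Rightarrow> real \<Rightarrow> 'a \<Rightarrow> bool"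
  where
  "sufficient_step F y c \<gamma> u \<Delta> s \<longleftrightarrow>
     norm s \<le> \<gamma> * \<Delta> \<and>
     model F y u 0 - model F y u s \<ge>
       c * norm (adjoint (dF F u) (residual F y u)) *
       min \<Delta> (norm (adjoint (dF F u) (residual F y u)) / onorm (adjoint (dF F u) \<circ> dF F u))"

definition lipschitz_cont_diff_on :: "'a::real_inner set \<Rightarrow> ('a \<Rightarrow> real) \<Rightarrow> bool" where
  "lipschitz_cont_diff_on N r \<longleftrightarrow>
     (\<forall>u\<in>N. r differentiable (at u)) \<and> (\<exists>K. K-lipschitz_on N (gradient r))"

text \<open>
  Convergence of the iterates to critical points in the sense of global convergence theory for
  trust region methods: the gradients tend to zero, and every subsequence has a further
  subsequence converging to a critical point. (Convergence of the whole sequence to one point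
  cannot be expected. With \<open>h y = (max (\<bar>y\<bar> - 1) 0)\<^sup>2\<close>, \<open>F (x, y) = (x + x\<^sup>2, h y)\<close> and
  data \<open>0\<close>, exact Gauss--Newton steps are only determined up to the kernel of the derivative,
  and may jump between \<open>y = 1/2\<close> and \<open>y = -1/2\<close> forever while \<open>x\<close> tends to 0.)
\<close>

definition converges_to_critical_points ::
  "('a::real_inner \<Rightarrow> real) \<Rightarrow> (nat \<Rightarrow> 'a) \<Rightarrow> bool" where
  "converges_to_critical_points f u \<longleftrightarrow>
     (\<lambda>k. gradient f (u k)) \<longlonglongrightarrow> 0 \<and>
     (\<forall>\<phi>::nat \<Rightarrow> nat. strict_mono \<phi> \<longrightarrow>
        (\<exists>(\<psi>::nat \<Rightarrow> nat) z. strict_mono \<psi> \<and> critical_point f z \<and> (u \<circ> \<phi> \<circ> \<psi>) \<longlonglongrightarrow> z))"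

end

theory Submission
  imports Defs
begin

text \<open>
  On the compact level set the derivative of \<open>F\<close> is bounded and the model agrees with the
  objective up to a quadratic error. As long as the gradients stay above \<open>e > 0\<close>, trials with a
  small radius therefore have ratio at least 1/4, so the radii stay away from 0 and every iteration
  decreases \<open>f\<close> by a fixed amount; this is impossible, so the gradients come arbitrarily close to 0.
  Both branches of the iteration decrease \<open>f\<close> by at least \<open>min \<eta> \<kappa>\<close> times the model decrease of
  \<open>s\<^sub>k\<close>, and both move by at most a constant times the radius (for the modified step
  because \<open>L\<close> and \<open>g\<close> are bounded). Hence, while the gradients stay above \<open>e\<close>, the distance travelled
  is eventually controlled by the decrease of \<open>f\<close>, and uniform continuity of the gradient forbids
  returning from above \<open>2e\<close> to below \<open>e\<close> infinitely often.
\<close>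

section \<open>Gradients of the objective and of the residual components\<close>

text \<open>Since \<open>gradient\<close> is a definite description, uniqueness has to be shown: two
  representing vectors give the same functional, and evaluating it at their difference makes that
  difference orthogonal to itself.\<close>

lemma gradient_eqI:
  assumes "GDERIV f u :> d"
  shows "gradient f u = d"
  unfolding gradient_def
proof (rule the_equality[where P = "\<lambda>d. GDERIV f u :> d", OF assms])
  fix d' assume "GDERIV f u :> d'"
  then have "(\<lambda>h. h \<bullet> d') = (\<lambda>h. h \<bullet> d)"
    using assms has_derivative_unique unfolding gderiv_def by blast
  then have "(d' - d) \<bullet> d' = (d' - d) \<bullet> d"
    by metis
  then have "(d' - d) \<bullet> (d' - d) = 0"
    by (simp add: inner_diff_right)
  then show "d' = d"
    by simp
qed

lemma critical_point_iff:
  assumes "GDERIV f u :> d"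
  shows "critical_point f u \<longleftrightarrow> d = 0"
  using assms gradient_eqI unfolding critical_point_def by metis

lemma dF_has_derivative:
  assumes "F differentiable (at u)"
  shows "(F has_derivative dF F u) (at u)"
  using assms frechet_derivative_works by blast

lemma linear_dF:
  assumes "F differentiable (at u)"
  shows "linear (dF F u)"
  using dF_has_derivative[OF assms] has_derivative_linear by blast

lemma residual_has_derivative:
  assumes "F differentiable (at u)"
  shows "(residual F y has_derivative dF F u) (at u)"
  unfolding residual_def
  using has_derivative_diff[OF dF_has_derivative[OF assms] has_derivative_const[of y]] by simp

lemma GDERIV_lsq:
  fixes F :: "'a::euclidean_space \<Rightarrow> 'b::euclidean_space"
  assumes "F differentiable (at u)"
  shows "GDERIV (lsq F y) u :> adjoint (dF F u) (residual F y u)"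
proof -
  let ?r = "residual F y"
  have "((\<lambda>v. 1/2 * (?r v \<bullet> ?r v)) has_derivative
      (\<lambda>h. 1/2 * (?r u \<bullet> dF F u h + dF F u h \<bullet> ?r u))) (at u)"
    by (intro has_derivative_mult_right has_derivative_inner residual_has_derivative assms)
  moreover have "(\<lambda>v. 1/2 * (?r v \<bullet> ?r v)) = lsq F y"
    by (simp add: fun_eq_iff lsq_def power2_norm_eq_inner)
  moreover have "1/2 * (?r u \<bullet> dF F u h + dF F u h \<bullet> ?r u) = h \<bullet> adjoint (dF F u) (?r u)" for h
    using adjoint_works[OF linear_dF[OF assms], of h "?r u"] by (simp add: inner_commute)
  ultimately show ?thesis
    unfolding gderiv_def by simp
qed

lemma GDERIV_residual_component:
  fixes F :: "'a::euclidean_space \<Rightarrow> real^'m"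
  assumes "F differentiable (at u)"
  shows "GDERIV (\<lambda>v. residual F y v $ j) u :> adjoint (dF F u) (axis j 1)"
proof -
  have "((\<lambda>v. residual F y v $ j) has_derivative (\<lambda>h. dF F u h $ j)) (at u)"
    using bounded_linear.has_derivative[OF bounded_linear_vec_nth residual_has_derivative[OF assms]] .
  moreover have "dF F u h $ j = h \<bullet> adjoint (dF F u) (axis j 1)" for h
    using adjoint_works[OF linear_dF[OF assms], of h "axis j 1"] by (simp add: inner_axis)
  ultimately show ?thesis
    unfolding gderiv_def by simp
qed

text \<open>Smoothness is assumed for the gradients of the residual components; this identity turns
  such information into information on the derivative of \<open>F\<close>.\<close>

lemma dF_component:
  fixes F :: "'a::euclidean_space \<Rightarrow> real^'m"
  assumes "F differentiable (at u)"
  shows "dF F u h $ j = h \<bullet> gradient (\<lambda>v. residual F y v $ j) u"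
  using adjoint_works[OF linear_dF[OF assms], of h "axis j 1"]
  by (simp add: gradient_eqI[OF GDERIV_residual_component[OF assms]] inner_axis)

text \<open>Expanding the residual in the standard basis and using linearity of the adjoint. In this
  form the continuity of the gradient can be read off from the components.\<close>

lemma gradient_lsq_sum:
  fixes F :: "'a::euclidean_space \<Rightarrow> real^'m"
  assumes "F differentiable (at u)"
  shows "gradient (lsq F y) u =
    (\<Sum>j\<in>UNIV. (residual F y u $ j) *\<^sub>R gradient (\<lambda>v. residual F y v $ j) u)"
proof -
  let ?J = "adjoint (dF F u)"
  have lin: "linear ?J"
    using adjoint_linear[OF linear_dF[OF assms]] .
  have "?J (residual F y u) = ?J (\<Sum>j\<in>UNIV. (residual F y u $ j) *\<^sub>R axis j 1)"
    using basis_expansion[of "residual F y u"] by (simp add: scalar_mult_eq_scaleR)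
  also have "\<dots> = (\<Sum>j\<in>UNIV. (residual F y u $ j) *\<^sub>R ?J (axis j 1))"
    by (simp add: linear_sum[OF lin] linear_scale[OF lin])
  finally show ?thesis
    by (simp add: gradient_eqI[OF GDERIV_lsq[OF assms]]
        gradient_eqI[OF GDERIV_residual_component[OF assms]])
qed

section \<open>Adjoint bounds\<close>

text \<open>Testing the adjoint identity with \<open>adjoint f w\<close> itself gives its squared
  norm, to which Cauchy-Schwarz and the bound on \<open>f\<close> apply; one factor then
  cancels.\<close>

lemma norm_adjoint_le:
  fixes f :: "'a::euclidean_space \<Rightarrow> 'b::euclidean_space"
  assumes "linear f" and bound: "\<And>x. norm (f x) \<le> A * norm x"
  shows "norm (adjoint f w) \<le> A * norm w"
proof (cases "adjoint f w = 0")
  case True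
  \<comment> \<open>The sign of \<open>A\<close> has to be extracted from the bound, using a vector
    of norm 1; a basis vector exists in every Euclidean space.\<close>
  have "0 \<le> A * norm x" for x :: 'a
    using order_trans[OF norm_ge_zero bound] .
  then have "0 \<le> A * norm (SOME b::'a. b \<in> Basis)"
    by blast
  then have "0 \<le> A"
    by (simp add: some_in_eq)
  then show ?thesis
    using True by simp
next
  case False
  let ?v = "adjoint f w"
  have "norm ?v * norm ?v = ?v \<bullet> ?v"
    by (simp add: power2_norm_eq_inner flip: power2_eq_square)
  also have "\<dots> = f ?v \<bullet> w"
    using adjoint_works[OF assms(1), of ?v w] by simp
  also have "\<dots> \<le> norm (f ?v) * norm w"
    by (rule norm_cauchy_schwarz)
  also have "\<dots> \<le> (A * norm ?v) * norm w"
    by (intro mult_right_mono bound norm_ge_zero)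
  finally have "norm ?v * norm ?v \<le> (A * norm w) * norm ?v"
    by (simp add: mult_ac)
  then show ?thesis
    using False by simp
qed

text \<open>These bounds control the denominator in the sufficient-decrease condition. It is
  positive because a vanishing composition would give \<open>f x \<bullet> f x = 0\<close> for all
  \<open>x\<close>, hence \<open>f = 0\<close> and a zero adjoint.\<close>

lemma onorm_adjoint_comp_bounds:
  fixes f :: "'a::euclidean_space \<Rightarrow> 'b::euclidean_space"
  assumes f: "linear f" and bound: "\<And>x. norm (f x) \<le> A * norm x" and "0 \<le> A"
    and nz: "adjoint f w \<noteq> 0"
  shows "0 < onorm (adjoint f \<circ> f)" "onorm (adjoint f \<circ> f) \<le> A\<^sup>2"
proof -
  have bl: "bounded_linear (adjoint f \<circ> f)"
    using f linear_compose adjoint_linear linear_conv_bounded_linear by blast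
  show "onorm (adjoint f \<circ> f) \<le> A\<^sup>2"
  proof (rule onorm_le)
    fix x
    have "norm (adjoint f (f x)) \<le> A * norm (f x)"
      by (rule norm_adjoint_le[OF f bound])
    also have "\<dots> \<le> A * (A * norm x)"
      by (intro mult_left_mono bound assms)
    finally show "norm ((adjoint f \<circ> f) x) \<le> A\<^sup>2 * norm x"
      by (simp add: power2_eq_square mult_ac)
  qed
  have "onorm (adjoint f \<circ> f) \<noteq> 0"
  proof
    assume "onorm (adjoint f \<circ> f) = 0"
    then have "adjoint f (f x) = 0" for x
      using onorm_eq_0[OF bl] by simp
    then have "f x \<bullet> f x = 0" for x
      using adjoint_works[OF f, of x "f x"] by simp
    then have "adjoint f w \<bullet> adjoint f w = 0"
      using adjoint_works[OF f, of "adjoint f w" w] by simp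
    then show False
      using nz by simp
  qed
  then show "0 < onorm (adjoint f \<circ> f)"
    using onorm_pos_le[OF bl] by linarith
qed

section \<open>Consequences of Lipschitz continuous residual gradients\<close>

lemma norm_vec_le_sum:
  fixes x :: "real^'m"
  assumes "\<And>j. \<bar>x $ j\<bar> \<le> b j"
  shows "norm x \<le> (\<Sum>j\<in>UNIV. b j)"
  using norm_le_l1_cart[of x] sum_mono[of UNIV "\<lambda>j. \<bar>x $ j\<bar>" b] assms by force

text \<open>Lipschitz gradients are uniformly continuous and thus bounded on bounded sets; the
  component bounds are added up.\<close>

lemma dF_bounded_on:
  fixes F :: "'a::euclidean_space \<Rightarrow> real^'m"
  assumes diff: "\<And>v. F differentiable (at v)"
    and smooth: "\<And>j. lipschitz_cont_diff_on N (\<lambda>v. residual F y v $ j)"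
    and S: "bounded S" "S \<subseteq> N"
  obtains A where "0 < A" "\<And>u h. u \<in> S \<Longrightarrow> norm (dF F u h) \<le> A * norm h"
proof -
  have "\<exists>b. \<forall>u\<in>S. norm (gradient (\<lambda>v. residual F y v $ j) u) \<le> b" for j
  proof -
    obtain K where K: "K-lipschitz_on N (gradient (\<lambda>v. residual F y v $ j))"
      using smooth[of j] unfolding lipschitz_cont_diff_on_def by blast
    have "bounded (gradient (\<lambda>v. residual F y v $ j) ` S)"
      using lipschitz_on_uniformly_continuous[OF lipschitz_on_subset[OF K S(2)]] S(1)
      by (rule bounded_uniformly_continuous_image)
    then show ?thesis
      by (auto simp: bounded_iff)
  qed
  then obtain b where b: "\<And>j u. u \<in> S \<Longrightarrow> norm (gradient (\<lambda>v. residual F y v $ j) u) \<le> b j"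
    by metis
  show thesis
  proof
    \<comment> \<open>The absolute value covers an empty \<open>S\<close>, for which
      \<open>b\<close> may be negative; the summand 1 makes the constant strictly positive.\<close>
    show "0 < \<bar>\<Sum>j\<in>UNIV. b j\<bar> + 1"
      by linarith
    fix u h assume u: "u \<in> S"
    have "norm (dF F u h) \<le> (\<Sum>j\<in>UNIV. norm h * b j)"
    proof (rule norm_vec_le_sum)
      fix j
      have "\<bar>dF F u h $ j\<bar> \<le> norm h * norm (gradient (\<lambda>v. residual F y v $ j) u)"
        unfolding dF_component[OF diff, of u h j y] by (rule Cauchy_Schwarz_ineq2)
      also have "\<dots> \<le> norm h * b j"
        by (intro mult_left_mono b u norm_ge_zero)
      finally show "\<bar>dF F u h $ j\<bar> \<le> norm h * b j" .
    qed
    also have "\<dots> = norm h * (\<Sum>j\<in>UNIV. b j)"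
      by (simp add: sum_distrib_left)
    also have "\<dots> \<le> norm h * (\<bar>\<Sum>j\<in>UNIV. b j\<bar> + 1)"
      by (intro mult_left_mono norm_ge_zero) linarith
    finally show "norm (dF F u h) \<le> (\<bar>\<Sum>j\<in>UNIV. b j\<bar> + 1) * norm h"
      by (simp add: mult_ac)
  qed
qed

lemma continuous_on_gradient_lsq:
  fixes F :: "'a::euclidean_space \<Rightarrow> real^'m"
  assumes diff: "\<And>v. F differentiable (at v)"
    and smooth: "\<And>j. lipschitz_cont_diff_on N (\<lambda>v. residual F y v $ j)"
  shows "continuous_on N (gradient (lsq F y))"
proof -
  have "continuous_on N (residual F y)"
    by (intro continuous_at_imp_continuous_on ballI
        has_derivative_continuous[OF residual_has_derivative[OF diff]])
  moreover have "continuous_on N (gradient (\<lambda>v. residual F y v $ j))" for j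
    using smooth[of j] by (auto simp: lipschitz_cont_diff_on_def dest: lipschitz_on_continuous_on)
  ultimately have "continuous_on N (\<lambda>u. \<Sum>j\<in>UNIV.
      (residual F y u $ j) *\<^sub>R gradient (\<lambda>v. residual F y v $ j) u)"
    by (intro continuous_intros)
  then show ?thesis
    by (simp add: gradient_lsq_sum[OF diff])
qed

text \<open>Mean value inequality for each component: on the ball of radius \<open>norm s\<close>
  around \<open>u\<close> the gradient differs from that at \<open>u\<close> by at most
  \<open>K j * norm s\<close>, and the displacement contributes another factor
  \<open>norm s\<close>. The whole ball must lie in \<open>N\<close>, since \<open>N\<close> need
  not be convex.\<close>

lemma linearization_error:
  fixes F :: "'a::euclidean_space \<Rightarrow> real^'m"
  assumes diff: "\<And>v. F differentiable (at v)"
    and smooth: "\<And>j. lipschitz_cont_diff_on N (\<lambda>v. residual F y v $ j)"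
  obtains K where "0 < K"
    "\<And>u s :: 'a. cball u (norm s) \<subseteq> N \<Longrightarrow> norm (F (u + s) - F u - dF F u s) \<le> K * (norm s)\<^sup>2"
proof -
  let ?r = "\<lambda>j v. residual F y v $ j"
  have "\<exists>K. K-lipschitz_on N (gradient (?r j))" for j
    using smooth[of j] unfolding lipschitz_cont_diff_on_def by blast
  then obtain K where K: "\<And>j. (K j)-lipschitz_on N (gradient (?r j))"
    by metis
  then have K0: "0 \<le> K j" for j
    using lipschitz_on_nonneg by blast
  show thesis
  proof
    show "0 < (\<Sum>j\<in>UNIV. K j) + 1"
      using sum_nonneg[of UNIV K] K0 by force
    fix u s :: 'a assume ball: "cball u (norm s) \<subseteq> N"
    have "norm (F (u + s) - F u - dF F u s) \<le> (\<Sum>j\<in>UNIV. K j * (norm s)\<^sup>2)"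
    proof (rule norm_vec_le_sum)
      fix j
      have der: "(?r j has_derivative (\<lambda>h. h \<bullet> gradient (?r j) v)) (at v within cball u (norm s))" for v
        using GDERIV_residual_component[OF diff[of v], of y j]
        unfolding gradient_eqI[OF GDERIV_residual_component[OF diff[of v], of y j]] gderiv_def
        by (rule has_derivative_at_withinI)
      have seg: "u + \<tau> *\<^sub>R (u + s - u) \<in> cball u (norm s)" if "\<tau> \<in> {0..1}" for \<tau>
        using that by (simp add: dist_norm mult_left_le_one_le)
      have bound: "onorm ((\<lambda>h. h \<bullet> gradient (?r j) v) - (\<lambda>h. h \<bullet> gradient (?r j) u)) \<le> K j * norm s"
        if v: "v \<in> cball u (norm s)" for v
      proof (rule onorm_le)
        fix h
        have "norm (gradient (?r j) v - gradient (?r j) u) \<le> K j * dist v u"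
          using lipschitz_onD[OF K, of v u j] subsetD[OF ball v] subsetD[OF ball, of u]
          by (simp add: dist_norm)
        also have "\<dots> \<le> K j * norm s"
          using v K0 by (intro mult_left_mono) (auto simp: dist_commute)
        finally have le: "norm (gradient (?r j) v - gradient (?r j) u) \<le> K j * norm s" .
        have "norm (((\<lambda>h. h \<bullet> gradient (?r j) v) - (\<lambda>h. h \<bullet> gradient (?r j) u)) h)
            \<le> norm h * norm (gradient (?r j) v - gradient (?r j) u)"
          using Cauchy_Schwarz_ineq2[of h "gradient (?r j) v - gradient (?r j) u"]
          by (simp add: inner_diff_right)
        also have "\<dots> \<le> norm h * (K j * norm s)"
          by (intro mult_left_mono le norm_ge_zero)
        finally show "norm (((\<lambda>h. h \<bullet> gradient (?r j) v) - (\<lambda>h. h \<bullet> gradient (?r j) u)) h)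
            \<le> K j * norm s * norm h"
          by (simp add: mult_ac)
      qed
      have "norm (?r j (u + s) - ?r j u - (u + s - u) \<bullet> gradient (?r j) u)
          \<le> norm (u + s - u) * (K j * norm s)"
        by (rule differentiable_bound_linearization[where S = "cball u (norm s)", OF seg der bound])
          simp_all
      then show "\<bar>(F (u + s) - F u - dF F u s) $ j\<bar> \<le> K j * (norm s)\<^sup>2"
        by (simp add: dF_component[OF diff, of u s j y] residual_def power2_eq_square mult_ac)
    qed
    also have "\<dots> \<le> ((\<Sum>j\<in>UNIV. K j) + 1) * (norm s)\<^sup>2"
      by (simp add: sum_distrib_right distrib_right)
    finally show "norm (F (u + s) - F u - dF F u s) \<le> ((\<Sum>j\<in>UNIV. K j) + 1) * (norm s)\<^sup>2" .
  qed
qed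

section \<open>Quality of the model and of the trial steps\<close>

lemma model_0:
  assumes "F differentiable (at u)"
  shows "model F y u 0 = lsq F y u"
  using linear_0[OF linear_dF[OF assms]] by (simp add: model_def lsq_def)

text \<open>With the linearized residual \<open>r'\<close> and the linearization error
  \<open>d\<close>, the objective at \<open>u + s\<close> exceeds the model by exactly
  \<open>r' \<bullet> d + 1/2 * (norm d)\<^sup>2\<close>. The restriction
  \<open>norm s \<le> 1\<close> bounds \<open>r'\<close> independently of \<open>s\<close> and lets
  the second term be absorbed into a quadratic one.\<close>

lemma model_error:
  assumes r: "norm (residual F y u) \<le> b" and J: "norm (dF F u s) \<le> A * norm s"
    and e: "norm (F (u + s) - F u - dF F u s) \<le> K * (norm s)\<^sup>2"
    and nn: "0 \<le> A" "0 \<le> K" and s: "norm s \<le> 1"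
  shows "lsq F y (u + s) - model F y u s \<le> ((b + A) * K + K\<^sup>2 / 2) * (norm s)\<^sup>2"
proof -
  define r' d where "r' = residual F y u + dF F u s" and "d = F (u + s) - F u - dF F u s"
  have "residual F y (u + s) = r' + d"
    by (simp add: r'_def d_def residual_def)
  then have "lsq F y (u + s) = 1/2 * (r' \<bullet> r') + r' \<bullet> d + 1/2 * (norm d)\<^sup>2"
    unfolding lsq_def by (simp add: power2_norm_eq_inner inner_add inner_commute algebra_simps)
  moreover have "model F y u s = 1/2 * (r' \<bullet> r')"
    unfolding model_def r'_def
    by (simp add: power2_norm_eq_inner inner_add inner_commute algebra_simps)
  moreover have "r' \<bullet> d \<le> ((b + A) * K) * (norm s)\<^sup>2"
  proof -
    have "norm r' \<le> b + A"
      using norm_triangle_ineq[of "residual F y u" "dF F u s"] r J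
        mult_left_mono[OF s nn(1)] unfolding r'_def by linarith
    then have "norm r' * norm d \<le> (b + A) * (K * (norm s)\<^sup>2)"
      using e order_trans[OF norm_ge_zero] unfolding d_def by (intro mult_mono) auto
    then show ?thesis
      using norm_cauchy_schwarz[of r' d] by (simp add: mult_ac)
  qed
  moreover have "(norm d)\<^sup>2 \<le> K\<^sup>2 * (norm s)\<^sup>2"
  proof -
    have "norm d \<le> K * norm s"
      using e mult_left_mono[OF mult_left_mono[OF s norm_ge_zero[of s]] nn(2)]
      unfolding d_def power2_eq_square mult_1_right by (rule order_trans)
    then show ?thesis
      by (metis norm_ge_zero power_mono power_mult_distrib)
  qed
  ultimately show ?thesis
    by (simp add: algebra_simps)
qed

text \<open>Replacing the operator norm by the larger \<open>A\<^sup>2\<close> weakens the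
  guaranteed decrease, but removes the dependence of the denominator on \<open>u\<close>.\<close>

lemma sufficient_step_decrease:
  fixes F :: "'a::euclidean_space \<Rightarrow> 'b::euclidean_space"
  assumes step: "sufficient_step F y c \<gamma> u \<Delta> s" and diff: "F differentiable (at u)"
    and J: "\<And>h. norm (dF F u h) \<le> A * norm h" and "0 < A" "0 < c"
    and crit: "\<not> critical_point (lsq F y) u"
  shows "c * norm (gradient (lsq F y) u) * min \<Delta> (norm (gradient (lsq F y) u) / A\<^sup>2)
    \<le> model F y u 0 - model F y u s"
proof -
  let ?d = "adjoint (dF F u) (residual F y u)"
  have g: "gradient (lsq F y) u = ?d"
    using gradient_eqI[OF GDERIV_lsq[OF diff]] .
  have "?d \<noteq> 0"
    using crit critical_point_iff[OF GDERIV_lsq[OF diff]] by blast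
  then have "0 < onorm (adjoint (dF F u) \<circ> dF F u)" "onorm (adjoint (dF F u) \<circ> dF F u) \<le> A\<^sup>2"
    using onorm_adjoint_comp_bounds[OF linear_dF[OF diff] J] \<open>0 < A\<close> by auto
  then have "norm ?d / A\<^sup>2 \<le> norm ?d / onorm (adjoint (dF F u) \<circ> dF F u)"
    by (intro divide_left_mono mult_pos_pos) (use \<open>0 < A\<close> in auto)
  then have "c * norm ?d * min \<Delta> (norm ?d / A\<^sup>2)
      \<le> c * norm ?d * min \<Delta> (norm ?d / onorm (adjoint (dF F u) \<circ> dF F u))"
    using \<open>0 < c\<close> by (intro mult_left_mono min.mono) auto
  then show ?thesis
    using step unfolding sufficient_step_def g by linarith
qed

text \<open>For a small radius the minimum in the decrease condition is \<open>\<Delta>\<close>, so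
  the predicted decrease is at least \<open>c * e * \<Delta>\<close>, linear in the radius. The
  model error is quadratic in the radius and takes away at most three quarters of it.\<close>

lemma agreement_ratio_ge_quarter:
  fixes F :: "'a::euclidean_space \<Rightarrow> 'b::euclidean_space"
  assumes step: "sufficient_step F y c \<gamma> u \<Delta> s" and diff: "F differentiable (at u)"
    and J: "\<And>h. norm (dF F u h) \<le> A * norm h" and pos: "0 < A" "0 < c" "0 < \<Delta>" "0 \<le> E"
    and crit: "\<not> critical_point (lsq F y) u"
    and err: "lsq F y (u + s) - model F y u s \<le> E * (norm s)\<^sup>2"
    and e: "0 < e" "e \<le> norm (gradient (lsq F y) u)"
    and small: "\<Delta> \<le> e / A\<^sup>2" "E * \<gamma>\<^sup>2 * \<Delta> \<le> 3/4 * (c * e)"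
  shows "1/4 \<le> agreement_ratio F y u s"
proof -
  let ?p = "model F y u 0 - model F y u s"
  let ?g = "norm (gradient (lsq F y) u)"
  have "\<Delta> \<le> ?g / A\<^sup>2"
    using small(1) divide_right_mono[OF e(2), of "A\<^sup>2"] by simp
  then have "c * ?g * \<Delta> \<le> ?p"
    using sufficient_step_decrease[OF step diff J pos(1,2) crit] by (simp add: min_absorb1)
  moreover have "c * e * \<Delta> \<le> c * ?g * \<Delta>"
    using e pos by (intro mult_right_mono mult_left_mono) auto
  ultimately have p: "c * e * \<Delta> \<le> ?p"
    by linarith
  moreover have "0 < c * e * \<Delta>"
    using pos e by simp
  ultimately have p0: "0 < ?p"
    by linarith
  have "norm s \<le> \<gamma> * \<Delta>"
    using step unfolding sufficient_step_def by blast
  then have "(norm s)\<^sup>2 \<le> (\<gamma> * \<Delta>)\<^sup>2"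
    by (intro power_mono norm_ge_zero)
  then have "E * (norm s)\<^sup>2 \<le> E * (\<gamma> * \<Delta>)\<^sup>2"
    using pos by (intro mult_left_mono)
  also have "\<dots> = (E * \<gamma>\<^sup>2 * \<Delta>) * \<Delta>"
    by (simp add: power2_eq_square mult_ac)
  also have "\<dots> \<le> 3/4 * (c * e) * \<Delta>"
    using small(2) pos by (intro mult_right_mono) auto
  also have "\<dots> = 3/4 * (c * e * \<Delta>)"
    by simp
  also have "\<dots> \<le> 3/4 * ?p"
    using p by (intro mult_left_mono) auto
  finally have "lsq F y (u + s) - model F y u s \<le> 3/4 * ?p"
    using err by linarith
  then have "?p / 4 \<le> lsq F y u - lsq F y (u + s)"
    using model_0[OF diff, of y] by simp
  then show ?thesis
    unfolding agreement_ratio_def using p0 by (simp add: pos_le_divide_eq)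
qed

text \<open>The bound by \<open>\<Delta>max\<close> is needed because the update truncates at \<open>\<Delta>max\<close> also when
  \<open>\<Delta> > \<Delta>max\<close>.\<close>

lemma radius_update_ge:
  assumes "0 < m" "m \<le> \<Delta>" "m \<le> d / 4" "m \<le> \<Delta>max"
    and "\<Delta> \<le> d \<Longrightarrow> 1/4 \<le> agreement_ratio F y u s"
  shows "m \<le> radius_update F y \<Delta>max u s \<Delta>"
  using assms unfolding radius_update_def by (cases "\<Delta> \<le> d") auto

lemma radius_update_pos:
  assumes "0 < \<Delta>" "0 < \<Delta>max"
  shows "0 < radius_update F y \<Delta>max u s \<Delta>"
  using assms unfolding radius_update_def by auto

section \<open>Vanishing gradients from sufficient decrease\<close>

text \<open>The convergence argument freed from the algorithm: \<open>\<phi>\<close> stands for the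
  objective values, \<open>\<delta>\<close> for the accepted radii and \<open>\<Gamma>\<close> for
  the gradient. First the gradients are shown to come arbitrarily close to 0, then to stay
  there.\<close>

lemma tendsto_zero_of_decrease:
  fixes u :: "nat \<Rightarrow> 'a::metric_space" and \<Gamma> :: "'a \<Rightarrow> 'b::real_normed_vector"
    and \<phi> \<delta> :: "nat \<Rightarrow> real"
  assumes ucont: "uniformly_continuous_on S \<Gamma>" and S: "\<And>k. u k \<in> S"
    and lower: "\<And>k. 0 \<le> \<phi> k" and mono: "\<And>k. \<phi> (Suc k) \<le> \<phi> k"
    and decrease: "\<And>k. c * norm (\<Gamma> (u k)) * min (\<delta> k) (norm (\<Gamma> (u k)) / B) \<le> \<phi> k - \<phi> (Suc k)"
    and pos: "0 < c" "0 < B" "0 < M" and \<delta>0: "\<And>k. 0 \<le> \<delta> k"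
    and step: "\<And>k. dist (u (Suc k)) (u k) \<le> M * \<delta> k"
    and radii: "\<And>e K. 0 < e \<Longrightarrow> (\<And>k. K \<le> k \<Longrightarrow> e \<le> norm (\<Gamma> (u k))) \<Longrightarrow>
      \<exists>d>0. \<forall>k\<ge>K. d \<le> \<delta> k"
  shows "(\<lambda>k. \<Gamma> (u k)) \<longlonglongrightarrow> 0"
proof -
  have dec: "decseq \<phi>"
    using mono by (rule decseq_SucI)
  obtain l where lim: "\<phi> \<longlonglongrightarrow> l"
    using decseq_convergent[OF dec] lower by metis
  have lb: "l \<le> \<phi> k" for k
    using decseq_ge[OF dec lim] .
  have near: "\<exists>K. \<forall>k\<ge>K. \<phi> k < l + x" if "0 < x" for x
    using order_tendstoD(2)[OF lim, of "l + x"] that by (auto simp: eventually_sequentially)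
  have ge: "c * e * min (\<delta> k) (e / B) \<le> \<phi> k - \<phi> (Suc k)"
    if "0 < e" "e \<le> norm (\<Gamma> (u k))" for e k
  proof -
    have "c * e * min (\<delta> k) (e / B) \<le> c * norm (\<Gamma> (u k)) * min (\<delta> k) (norm (\<Gamma> (u k)) / B)"
      using that pos \<delta>0[of k]
      by (intro mult_mono mult_left_mono min.mono divide_right_mono) auto
    then show ?thesis
      using decrease[of k] by linarith
  qed
  have small: "\<exists>k\<ge>K. norm (\<Gamma> (u k)) < e" if e: "0 < e" for e K
  proof (rule ccontr)
    assume "\<not> ?thesis"
    then have big: "e \<le> norm (\<Gamma> (u k))" if "K \<le> k" for k
      using that by force
    then obtain d where d: "0 < d" "\<And>k. K \<le> k \<Longrightarrow> d \<le> \<delta> k"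
      using radii[OF e] by blast
    \<comment> \<open>A decrease guaranteed in every iteration from \<open>K\<close> on, which
      contradicts convergence of \<open>\<phi>\<close>.\<close>
    define x where "x = c * e * min d (e / B)"
    have "0 < x"
      using pos e d by (simp add: x_def)
    then obtain K' where K': "\<And>k. K' \<le> k \<Longrightarrow> \<phi> k < l + x"
      using near by blast
    let ?k = "max K K'"
    have "x \<le> c * e * min (\<delta> ?k) (e / B)"
      unfolding x_def using pos e d(2)[of ?k] by (intro mult_left_mono min.mono) auto
    also have "\<dots> \<le> \<phi> ?k - \<phi> (Suc ?k)"
      using ge[OF e big[of ?k]] by simp
    also have "\<dots> < x"
      using K'[of ?k] lb[of "Suc ?k"] by simp
    finally show False
      by simp
  qed
  have "\<exists>K. \<forall>k\<ge>K. norm (\<Gamma> (u k)) < 2 * e" if e: "0 < e" for e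
  proof -
    obtain h where h: "0 < h"
      "\<And>v w. v \<in> S \<Longrightarrow> w \<in> S \<Longrightarrow> dist v w < h \<Longrightarrow> dist (\<Gamma> v) (\<Gamma> w) < e"
      using ucont e unfolding uniformly_continuous_on_def by metis
    \<comment> \<open>Once \<open>\<phi>\<close> is within \<open>x\<close> of its limit, the first
      term forces the minimum in \<open>ge\<close> to be the radius, and the second keeps the
      distance travelled with gradients above \<open>e\<close> below \<open>h\<close>.\<close>
    define x where "x = min (c * e * (e / B)) (c * e * h / M)"
    have "0 < x"
      using pos e h by (simp add: x_def)
    then obtain K where K: "\<And>k. K \<le> k \<Longrightarrow> \<phi> k < l + x"
      using near by blast
    have move: "dist (u (Suc k)) (u k) \<le> M / (c * e) * (\<phi> k - \<phi> (Suc k))"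
      if k: "K \<le> k" "e \<le> norm (\<Gamma> (u k))" for k
    proof -
      have "\<phi> k - \<phi> (Suc k) < c * e * (e / B)"
        using K[OF k(1)] lb[of "Suc k"] unfolding x_def by linarith
      then have "min (\<delta> k) (e / B) \<noteq> e / B"
        using ge[OF e k(2)] by auto
      then have "c * e * \<delta> k \<le> \<phi> k - \<phi> (Suc k)"
        using ge[OF e k(2)] by (simp add: min_def split: if_splits)
      then have "\<delta> k \<le> (\<phi> k - \<phi> (Suc k)) / (c * e)"
        using pos e by (simp add: pos_le_divide_eq mult_ac)
      then have "M * \<delta> k \<le> M * ((\<phi> k - \<phi> (Suc k)) / (c * e))"
        using pos by (intro mult_left_mono) auto
      then show ?thesis
        using step[of k] by simp
    qed
    have "norm (\<Gamma> (u k)) < 2 * e" if k: "K \<le> k" for k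
    proof (rule ccontr)
      assume big: "\<not> norm (\<Gamma> (u k)) < 2 * e"
      \<comment> \<open>The first return below \<open>e\<close> is chosen, so that
        \<open>move\<close> applies to every step before it and the bounds telescope.\<close>
      have "\<exists>i. norm (\<Gamma> (u (k + i))) < e"
        using small[OF e, of k] le_Suc_ex by blast
      then obtain i where i: "norm (\<Gamma> (u (k + i))) < e"
        "\<And>j. j < i \<Longrightarrow> \<not> norm (\<Gamma> (u (k + j))) < e"
        using exists_least_iff[of "\<lambda>i. norm (\<Gamma> (u (k + i))) < e"] by auto
      have "dist (u (k + j)) (u k) \<le> M / (c * e) * (\<phi> k - \<phi> (k + j))" if "j \<le> i" for j
        using that
      proof (induction j)
        case (Suc j)
        have "dist (u (k + Suc j)) (u k) \<le> dist (u (Suc (k + j))) (u (k + j)) + dist (u (k + j)) (u k)"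
          using dist_triangle by simp
        also have "\<dots> \<le> M / (c * e) * (\<phi> (k + j) - \<phi> (Suc (k + j))) + M / (c * e) * (\<phi> k - \<phi> (k + j))"
          using Suc i(2)[of j] k by (intro add_mono move) auto
        finally show ?case
          by (simp add: algebra_simps)
      qed simp
      then have "dist (u (k + i)) (u k) \<le> M / (c * e) * (\<phi> k - \<phi> (k + i))"
        by simp
      also have "\<dots> < M / (c * e) * (c * e * h / M)"
      proof (rule mult_strict_left_mono)
        show "\<phi> k - \<phi> (k + i) < c * e * h / M"
          using K[OF k] lb[of "k + i"] unfolding x_def by linarith
      qed (use pos e in simp)
      also have "\<dots> = h"
        using pos e by simp
      finally have "dist (\<Gamma> (u (k + i))) (\<Gamma> (u k)) < e"
        using h(2) S by blast
      then show False
        using big i(1) norm_triangle_sub[of "\<Gamma> (u k)" "\<Gamma> (u (k + i))"]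
        by (simp add: dist_norm norm_minus_commute)
    qed
    then show ?thesis
      by blast
  qed
  from this[of "e / 2" for e] show ?thesis
    by (simp add: LIMSEQ_iff)
qed

section \<open>Decrease and radii along the iteration\<close>

text \<open>Serves both branches of the iteration, with \<open>\<tau>\<close> being
  \<open>\<eta>\<close> or \<open>\<kappa>\<close> and \<open>\<sigma>\<close> their minimum. The
  bound \<open>p\<close> makes the denominator of the ratio positive.\<close>

lemma agreement_ratio_decrease:
  assumes "\<tau> < agreement_ratio F y u s" "0 < \<tau>" "\<sigma> \<le> \<tau>" "0 < p"
    "p \<le> model F y u 0 - model F y u s"
  shows "\<sigma> * p \<le> lsq F y u - lsq F y (u + s)"
proof -
  have "\<sigma> * p \<le> \<tau> * (model F y u 0 - model F y u s)"
    using assms by (intro mult_mono) auto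
  also have "\<dots> \<le> lsq F y u - lsq F y (u + s)"
    using assms unfolding agreement_ratio_def by (simp add: pos_less_divide_eq)
  finally show ?thesis .
qed

lemma norm_componentwise_product_le:
  fixes a b :: "real^'n"
  shows "norm (\<chi> i. a $ i * b $ i) \<le> norm a * norm b"
proof -
  have "norm (\<chi> i. a $ i * b $ i) \<le> norm (norm b *\<^sub>R a)"
  proof (rule norm_le_componentwise_cart)
    fix i
    have "\<bar>a $ i\<bar> * \<bar>b $ i\<bar> \<le> \<bar>a $ i\<bar> * norm b"
      by (intro mult_left_mono component_le_norm_cart abs_ge_zero)
    then show "norm ((\<chi> i. a $ i * b $ i) $ i) \<le> norm ((norm b *\<^sub>R a) $ i)"
      by (simp add: abs_mult mult_ac)
  qed
  then show ?thesis
    by (simp add: mult_ac)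
qed

text \<open>Nested induction, over the trials at one iterate and over the iterates. Radii are linked
  only at noncritical iterates, so \<open>stay\<close> is what supplies noncriticality of all
  iterates between \<open>K\<close> and \<open>k\<close>.\<close>

lemma lma_radii_invariant:
  assumes LMA: "lma_steps F y C \<Delta>max \<eta> u n t \<Delta> \<beta> \<epsilon> s"
    and stay: "\<And>k. \<not> critical_point (lsq F y) (u (Suc k)) \<Longrightarrow> \<not> critical_point (lsq F y) (u k)"
    and start: "P (\<Delta> K 0)"
    and step: "\<And>k j. K \<le> k \<Longrightarrow> \<not> critical_point (lsq F y) (u k) \<Longrightarrow> j \<le> n k \<Longrightarrow> P (\<Delta> k j) \<Longrightarrow>
      P (radius_update F y \<Delta>max (u k) (t k j) (\<Delta> k j))"
    and k: "K \<le> k" "\<not> critical_point (lsq F y) (u k)" and j: "j \<le> n k"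
  shows "P (\<Delta> k j)"
proof -
  have inner: "P (\<Delta> k j)"
    if k: "K \<le> k" "\<not> critical_point (lsq F y) (u k)" and 0: "P (\<Delta> k 0)" and j: "j \<le> n k" for k j
    using j
  proof (induction j)
    case (Suc j)
    have "lma_trials F y C \<Delta>max \<eta> (u k) (n k) (t k) (\<Delta> k) (\<beta> k) (\<epsilon> k)"
      using LMA k unfolding lma_steps_def by metis
    then have "\<Delta> k (Suc j) = radius_update F y \<Delta>max (u k) (t k j) (\<Delta> k j)"
      using Suc.prems unfolding lma_trials_def by simp
    then show ?case
      using step[OF k, of j] Suc by simp
  qed (use 0 in simp)
  have "P (\<Delta> k 0)"
    using k
  proof (induction k rule: dec_induct)
    case (step k)
    have nc: "\<not> critical_point (lsq F y) (u k)"
      using stay step.prems by blast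
    then have "\<Delta> (Suc k) 0 = radius_update F y \<Delta>max (u k) (t k (n k)) (\<Delta> k (n k))"
      using LMA unfolding lma_steps_def by metis
    moreover have "P (\<Delta> k (n k))"
      using inner[OF step.hyps(1) nc step.IH[OF nc]] by simp
    ultimately show ?case
      using assms(4)[OF step.hyps(1) nc, of "n k"] by simp
  qed (rule start)
  then show ?thesis
    using inner[OF k _ j] by blast
qed

text \<open>Compactness provides a margin \<open>R\<close> by which balls around points of
  \<open>S\<close> fit into \<open>N\<close>; hence the threshold \<open>d\<close> does not depend
  on the iterate.\<close>

lemma small_trials_agree:
  fixes F :: "'a::euclidean_space \<Rightarrow> real^'m"
  assumes diff: "\<And>v. F differentiable (at v)"
    and smooth: "\<And>j. lipschitz_cont_diff_on N (\<lambda>v. residual F y v $ j)" and "open N"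
    and S: "compact S" "S \<subseteq> N" and res: "\<And>u. u \<in> S \<Longrightarrow> norm (residual F y u) \<le> b"
    and J: "\<And>u h. u \<in> S \<Longrightarrow> norm (dF F u h) \<le> A * norm h"
    and pos: "0 < A" "0 < c" "1 \<le> \<gamma>" "0 < e"
  obtains d where "0 < d"
    "\<And>u \<Delta> s. u \<in> S \<Longrightarrow> sufficient_step F y c \<gamma> u \<Delta> s \<Longrightarrow> \<not> critical_point (lsq F y) u \<Longrightarrow>
      e \<le> norm (gradient (lsq F y) u) \<Longrightarrow> 0 < \<Delta> \<Longrightarrow> \<Delta> \<le> d \<Longrightarrow> 1/4 \<le> agreement_ratio F y u s"
proof -
  obtain R where R: "0 < R" "(\<Union>x\<in>S. ball x R) \<subseteq> N"
    using compact_subset_open_imp_ball_epsilon_subset[OF S(1) \<open>open N\<close> S(2)] by metis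
  obtain K where K: "0 < K"
    "\<And>u s. cball u (norm s) \<subseteq> N \<Longrightarrow> norm (F (u + s) - F u - dF F u s) \<le> K * (norm s)\<^sup>2"
    using linearization_error[OF diff smooth] by metis
  define E where "E = (\<bar>b\<bar> + A) * K + K\<^sup>2 / 2"
  have E: "0 < E"
    using K(1) pos by (simp add: E_def add_nonneg_pos add_pos_pos)
  \<comment> \<open>In this order: the radius attains the minimum in the decrease condition, the
    ball around \<open>u\<close> stays in \<open>N\<close>, the step has norm at most 1, and the
    model error is at most three quarters of the predicted decrease.\<close>
  define d where "d = min (min (e / A\<^sup>2) (R / (2 * \<gamma>))) (min (1 / \<gamma>) (3/4 * (c * e) / (E * \<gamma>\<^sup>2)))"
  show thesis
  proof
    show "0 < d"
      using pos R E by (simp add: d_def)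
    fix u \<Delta> s
    assume u: "u \<in> S" and step: "sufficient_step F y c \<gamma> u \<Delta> s"
      and crit: "\<not> critical_point (lsq F y) u" and e: "e \<le> norm (gradient (lsq F y) u)"
      and \<Delta>: "0 < \<Delta>" "\<Delta> \<le> d"
    have \<Delta>': "\<Delta> \<le> e / A\<^sup>2" "\<gamma> * \<Delta> \<le> R / 2" "\<gamma> * \<Delta> \<le> 1" "E * \<gamma>\<^sup>2 * \<Delta> \<le> 3/4 * (c * e)"
      using \<Delta>(2) pos E unfolding d_def by (simp_all add: pos_le_divide_eq mult_ac)
    have "norm s \<le> \<gamma> * \<Delta>"
      using step unfolding sufficient_step_def by blast
    then have s: "norm s < R" "norm s \<le> 1"
      using \<Delta>' R by linarith+
    then have "cball u (norm s) \<subseteq> N"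
      using R(2) u by fastforce
    then have "lsq F y (u + s) - model F y u s \<le> E * (norm s)\<^sup>2"
      using res[OF u] J[OF u] K pos s unfolding E_def by (intro model_error) auto
    then show "1/4 \<le> agreement_ratio F y u s"
      using agreement_ratio_ge_quarter[OF step diff J[OF u] pos(1,2) \<Delta>(1) _ crit _ pos(4) e \<Delta>'(1,4)] E
      by simp
  qed
qed

theorem proposition3p2:
  fixes F :: "real^'n \<Rightarrow> real^'m" and y :: "real^'m"
    and C :: "(real^'n) set"
    and \<Delta>max \<eta> c1 \<gamma> \<kappa> :: real
    and L :: "real^'n \<Rightarrow> real^'n" and g G :: "(real^'n) \<times> (real^'n) \<Rightarrow> real^'n"
    and u s :: "nat \<Rightarrow> real^'n"
    and n :: "nat \<Rightarrow> nat" and t :: "nat \<Rightarrow> nat \<Rightarrow> real^'n"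
    and \<Delta> \<beta> \<epsilon> :: "nat \<Rightarrow> nat \<Rightarrow> real"
  assumes F_diff: "\<And>v. F differentiable (at v)"
    and C: "polyhedron C"
    and radii: "0 < \<Delta>max" "0 < \<Delta> 0 0" "\<Delta> 0 0 < \<Delta>max"
    and eta: "0 < \<eta>" "\<eta> < 1/4"
    and LMA: "lma_steps F y C \<Delta>max \<eta> u n t \<Delta> \<beta> \<epsilon> s"
    and level_bounded: "bounded {v. lsq F y v \<le> lsq F y (u 0)}"
    and residuals_smooth: "\<exists>N. open N \<and> {v. lsq F y v \<le> lsq F y (u 0)} \<subseteq> N \<and>
          (\<forall>j. lipschitz_cont_diff_on N (\<lambda>v. residual F y v $ j))"
    and constants: "c1 > 0" "\<gamma> \<ge> 1"
    and sufficient: "\<And>k j. \<not> critical_point (lsq F y) (u k) \<Longrightarrow> j \<le> n k \<Longrightarrow>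
          sufficient_step F y c1 \<gamma> (u k) (\<Delta> k j) (t k j)"
    and L: "bounded_linear L"
    and g: "bounded (range g)"
    and G: "\<And>v w. G (v, w) = v + (\<chi> i. L w $ i * g (v, w) $ i)"
    and kappa: "\<kappa> > 0"
    and iterates: "\<And>k. u (Suc k) =
          (if model F y (u k) (G (u k, s k) - u k) \<le> model F y (u k) (s k) \<and>
              agreement_ratio F y (u k) (G (u k, s k) - u k) > \<kappa>
           then G (u k, s k) else u k + s k)"
  shows "converges_to_critical_points (lsq F y) u"
proof -
  define f \<Gamma> S where "f = lsq F y" and "\<Gamma> = gradient f" and "S = {v. f v \<le> f (u 0)}"
  have GD: "GDERIV f v :> \<Gamma> v" for v
    using GDERIV_lsq[OF F_diff] gradient_eqI[OF GDERIV_lsq[OF F_diff]] unfolding f_def \<Gamma>_def by metis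
  have crit: "critical_point f v \<longleftrightarrow> \<Gamma> v = 0" for v
    using critical_point_iff[OF GD] .
  obtain N where N: "open N" "S \<subseteq> N"
    and smooth: "\<And>j. lipschitz_cont_diff_on N (\<lambda>v. residual F y v $ j)"
    using residuals_smooth unfolding S_def f_def by blast
  have "continuous_on UNIV f"
    using GD has_derivative_continuous continuous_at_imp_continuous_on unfolding gderiv_def by blast
  then have S: "compact S"
    using level_bounded unfolding compact_eq_bounded_closed S_def f_def
    by (simp add: closed_Collect_le continuous_on_const)
  have cont: "continuous_on S \<Gamma>"
    using continuous_on_subset[OF continuous_on_gradient_lsq[OF F_diff smooth] N(2)]
    unfolding \<Gamma>_def f_def .
  have f0: "0 \<le> f v" for v
    by (simp add: f_def lsq_def)
  obtain A where A: "0 < A" "\<And>v h. v \<in> S \<Longrightarrow> norm (dF F v h) \<le> A * norm h"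
    using dF_bounded_on[OF F_diff smooth compact_imp_bounded[OF S] N(2)] by metis
  have res: "norm (residual F y v) \<le> sqrt (2 * f (u 0))" if "v \<in> S" for v
    using that unfolding S_def f_def by (intro real_le_rsqrt) (simp add: lsq_def)

  \<comment> \<open>At a critical point the step is 0, and \<open>L 0 = 0\<close> makes both
    branches return the same point. Noncriticality is therefore inherited by earlier
    iterates.\<close>
  have persist: "u (Suc k) = u k" if "critical_point f (u k)" for k
  proof -
    have "s k = 0"
      using LMA that unfolding lma_steps_def f_def by metis
    moreover have "G (u k, 0) = u k"
      using bounded_linear.linear[OF L] by (simp add: G linear_0 vec_eq_iff)
    ultimately show ?thesis
      using iterates[of k] by simp
  qed
  have trials: "lma_trials F y C \<Delta>max \<eta> (u k) (n k) (t k) (\<Delta> k) (\<beta> k) (\<epsilon> k)" "s k = t k (n k)"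
    if "\<not> critical_point f (u k)" for k
    using LMA that unfolding lma_steps_def f_def by metis+
  have invariant: "P (\<Delta> k j)"
    if "P (\<Delta> K 0)" "\<And>k j. K \<le> k \<Longrightarrow> \<not> critical_point f (u k) \<Longrightarrow> j \<le> n k \<Longrightarrow> P (\<Delta> k j) \<Longrightarrow>
      P (radius_update F y \<Delta>max (u k) (t k j) (\<Delta> k j))"
      "K \<le> k" "\<not> critical_point f (u k)" "j \<le> n k" for P K k j
  proof (rule lma_radii_invariant[OF LMA, where P = P])
    show "\<not> critical_point (lsq F y) (u k)" if "\<not> critical_point (lsq F y) (u (Suc k))" for k
      using persist[of k] that unfolding f_def by auto
  qed (use that f_def in auto)
  have \<Delta>pos: "0 < \<Delta> k j" if "\<not> critical_point f (u k)" "j \<le> n k" for k j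
    by (rule invariant[where K = 0]) (use radii that in \<open>auto intro: radius_update_pos\<close>)

  \<comment> \<open>After termination the radii are unspecified; the value 0 fits because the
    iterate no longer moves.\<close>
  define \<delta> where "\<delta> k = (if critical_point f (u k) then 0 else \<Delta> k (n k))" for k
  obtain Bg where Bg: "\<And>x. norm (g x) \<le> Bg"
    using g by (auto simp: bounded_iff)
  obtain BL where BL: "\<And>x. norm (L x) \<le> norm x * BL" "0 < BL"
    using bounded_linear.pos_bounded[OF L] by blast
  \<comment> \<open>The summand 1 accounts for the plain step, \<open>BL * \<bar>Bg\<bar>\<close>
    for the modified one.\<close>
  define M where "M = (1 + BL * \<bar>Bg\<bar>) * \<gamma>"
  have M: "0 < M"
    unfolding M_def using BL(2) constants by (intro mult_pos_pos add_pos_nonneg) auto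
  have move: "dist (u (Suc k)) (u k) \<le> M * \<delta> k" for k
  proof (cases "critical_point f (u k)")
    case True
    then show ?thesis
      using persist by (simp add: \<delta>_def)
  next
    case False
    have s: "norm (s k) \<le> \<gamma> * \<Delta> k (n k)"
      using sufficient[of k "n k"] False trials(2) unfolding sufficient_step_def f_def by simp
    have "norm (G (u k, s k) - u k) \<le> norm (L (s k)) * norm (g (u k, s k))"
      by (simp add: G norm_componentwise_product_le)
    also have "\<dots> \<le> (norm (s k) * BL) * \<bar>Bg\<bar>"
      using BL Bg[of "(u k, s k)"] by (intro mult_mono) auto
    finally have "norm (G (u k, s k) - u k) \<le> (BL * \<bar>Bg\<bar>) * norm (s k)"
      by (simp add: mult_ac)
    then have "norm (G (u k, s k) - u k) \<le> norm (s k) + (BL * \<bar>Bg\<bar>) * norm (s k)"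
      by (rule add_increasing[OF norm_ge_zero])
    moreover have "norm (s k) \<le> norm (s k) + (BL * \<bar>Bg\<bar>) * norm (s k)"
      using BL by simp
    ultimately have "dist (u (Suc k)) (u k) \<le> (1 + BL * \<bar>Bg\<bar>) * norm (s k)"
      using iterates[of k] by (auto simp: dist_norm distrib_right)
    also have "\<dots> \<le> (1 + BL * \<bar>Bg\<bar>) * (\<gamma> * \<Delta> k (n k))"
      using s BL by (intro mult_left_mono) auto
    finally show ?thesis
      using False by (simp add: M_def \<delta>_def mult_ac)
  qed

  define \<sigma> where "\<sigma> = min \<eta> \<kappa>"
  have \<sigma>: "0 < \<sigma>"
    using eta kappa by (simp add: \<sigma>_def)
  have decrease: "\<sigma> * c1 * norm (\<Gamma> (u k)) * min (\<delta> k) (norm (\<Gamma> (u k)) / A\<^sup>2) \<le> f (u k) - f (u (Suc k))"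
    if uk: "u k \<in> S" for k
  proof (cases "critical_point f (u k)")
    case True
    then show ?thesis
      using crit persist by simp
  next
    case False
    define p where "p = c1 * norm (\<Gamma> (u k)) * min (\<Delta> k (n k)) (norm (\<Gamma> (u k)) / A\<^sup>2)"
    have "0 < p"
      unfolding p_def using False crit \<Delta>pos A(1) constants by simp
    have p: "p \<le> model F y (u k) 0 - model F y (u k) (s k)"
      using sufficient_step_decrease[OF _ F_diff A(2)[OF uk] A(1) constants(1)]
        sufficient[of k "n k"] False trials(2)[OF False] unfolding p_def \<Gamma>_def f_def by simp
    have "\<sigma> * p \<le> f (u k) - f (u (Suc k))"
    proof (cases "model F y (u k) (G (u k, s k) - u k) \<le> model F y (u k) (s k) \<and>
        agreement_ratio F y (u k) (G (u k, s k) - u k) > \<kappa>")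
      case True
      \<comment> \<open>The modified step has a model value no larger than that of
        \<open>s k\<close>, so \<open>p\<close> also bounds its predicted decrease.\<close>
      then have "\<sigma> * p \<le> lsq F y (u k) - lsq F y (u k + (G (u k, s k) - u k))"
        using p \<open>0 < p\<close> kappa
        by (intro agreement_ratio_decrease[of \<kappa>]) (auto simp: \<sigma>_def)
      then show ?thesis
        using True iterates[of k] by (simp add: f_def)
    next
      case no: False
      have "\<eta> < agreement_ratio F y (u k) (s k)"
        using trials[OF False] unfolding lma_trials_def by simp
      then have "\<sigma> * p \<le> lsq F y (u k) - lsq F y (u k + s k)"
        using p \<open>0 < p\<close> eta
        by (intro agreement_ratio_decrease[of \<eta>]) (auto simp: \<sigma>_def)
      moreover have "u (Suc k) = u k + s k"
        using no iterates[of k] by metis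
      ultimately show ?thesis
        by (simp add: f_def)
    qed
    then show ?thesis
      using False by (simp add: p_def \<delta>_def mult_ac)
  qed
  have \<delta>0: "0 \<le> \<delta> k" for k
    using \<Delta>pos[of k "n k"] by (auto simp: \<delta>_def)
  have mono: "f (u (Suc k)) \<le> f (u k)" if "u k \<in> S" for k
  proof -
    have "0 \<le> \<sigma> * c1 * norm (\<Gamma> (u k)) * min (\<delta> k) (norm (\<Gamma> (u k)) / A\<^sup>2)"
      using \<sigma> constants \<delta>0 by (intro mult_nonneg_nonneg) auto
    then show ?thesis
      using decrease[OF that] by linarith
  qed
  \<comment> \<open>The bound \<open>A\<close> is available only on the level set, so decrease and
    membership have to be established together: decrease at an iterate in \<open>S\<close> keeps the
    next one in \<open>S\<close>.\<close>
  have uS: "u k \<in> S" for k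
  proof (induction k)
    case (Suc k)
    then show ?case
      using mono[OF Suc] unfolding S_def by simp
  qed (simp add: S_def)

  have lim: "(\<lambda>k. \<Gamma> (u k)) \<longlonglongrightarrow> 0"
  proof (rule tendsto_zero_of_decrease[where u = u and \<Gamma> = \<Gamma> and S = S and \<phi> = "\<lambda>k. f (u k)"
        and \<delta> = \<delta> and c = "\<sigma> * c1" and B = "A\<^sup>2" and M = M])
    show "uniformly_continuous_on S \<Gamma>"
      using compact_uniformly_continuous[OF cont S] .
    show "\<sigma> * c1 * norm (\<Gamma> (u k)) * min (\<delta> k) (norm (\<Gamma> (u k)) / A\<^sup>2) \<le> f (u k) - f (u (Suc k))" for k
      using decrease[OF uS] .
    fix e :: real and K :: nat
    assume e: "0 < e" and big: "\<And>k. K \<le> k \<Longrightarrow> e \<le> norm (\<Gamma> (u k))"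
    then have nc: "\<not> critical_point f (u k)" if "K \<le> k" for k
      using that crit[of "u k"] by force
    obtain d where d: "0 < d"
      "\<And>v \<rho> w. v \<in> S \<Longrightarrow> sufficient_step F y c1 \<gamma> v \<rho> w \<Longrightarrow> \<not> critical_point f v \<Longrightarrow>
        e \<le> norm (\<Gamma> v) \<Longrightarrow> 0 < \<rho> \<Longrightarrow> \<rho> \<le> d \<Longrightarrow> 1/4 \<le> agreement_ratio F y v w"
      using small_trials_agree[OF F_diff smooth N(1) S N(2) res A(2) A(1) constants e]
      unfolding f_def \<Gamma>_def by metis
    \<comment> \<open>Radii up to \<open>d\<close> are not reduced by a poor ratio, and a larger one
      drops to no less than \<open>d / 4\<close>; the other two terms cover the starting value and
      the truncation. Rejected trials matter here too, so the decrease condition is used for every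
      \<open>j \<le> n k\<close>.\<close>
    define m where "m = min (\<Delta> K 0) (min (d / 4) \<Delta>max)"
    have "0 < m"
      using \<Delta>pos[OF nc, of K 0] d radii by (simp add: m_def)
    have "m \<le> \<Delta> k (n k)" if k: "K \<le> k" for k
    proof (rule invariant[where P = "\<lambda>x. m \<le> x", OF _ _ k nc[OF k] order_refl])
      fix i j assume i: "K \<le> i" and ij: "\<not> critical_point f (u i)" "j \<le> n i" "m \<le> \<Delta> i j"
      have "1/4 \<le> agreement_ratio F y (u i) (t i j)" if "\<Delta> i j \<le> d"
        using d(2)[OF uS _ ij(1) big[OF i] \<Delta>pos[OF ij(1,2)] that] sufficient ij
        unfolding f_def by blast
      then show "m \<le> radius_update F y \<Delta>max (u i) (t i j) (\<Delta> i j)"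
        using \<open>0 < m\<close> ij by (intro radius_update_ge[where d = d]) (auto simp: m_def)
    qed (simp add: m_def)
    then show "\<exists>d>0. \<forall>k\<ge>K. d \<le> \<delta> k"
      using \<open>0 < m\<close> nc unfolding \<delta>_def by auto
  qed (use uS f0 mono \<sigma> constants A(1) M move \<delta>0 in auto)

  have "\<exists>\<psi> z. strict_mono \<psi> \<and> critical_point f z \<and> (u \<circ> \<phi> \<circ> \<psi>) \<longlonglongrightarrow> z"
    if \<phi>: "strict_mono \<phi>" for \<phi> :: "nat \<Rightarrow> nat"
  proof -
    \<comment> \<open>Compactness yields the limit point inside \<open>S\<close>, where continuity
      of the gradient is known.\<close>
    obtain z \<psi> where z: "z \<in> S" "strict_mono (\<psi> :: nat \<Rightarrow> nat)" "(u \<circ> \<phi> \<circ> \<psi>) \<longlonglongrightarrow> z"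
      using S uS unfolding compact_def by (metis comp_apply)
    have "(\<Gamma> \<circ> (u \<circ> \<phi> \<circ> \<psi>)) \<longlonglongrightarrow> \<Gamma> z"
      using cont z uS unfolding continuous_on_sequentially by auto
    moreover have "(\<Gamma> \<circ> (u \<circ> \<phi> \<circ> \<psi>)) \<longlonglongrightarrow> 0"
      using LIMSEQ_subseq_LIMSEQ[OF lim strict_mono_o[OF \<phi> z(2)]] by (simp add: o_def)
    ultimately have "\<Gamma> z = 0"
      by (rule LIMSEQ_unique)
    then show ?thesis
      using z crit by blast
  qed
  then show ?thesis
    using lim unfolding converges_to_critical_points_def \<Gamma>_def f_def by blast
qed

end
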